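(* Let $\gamma\colon I\to N$ be an $r$-harmonic curve parametrized by arclength, where $N$ is a three-dimensional space form with constant curvature $K$. Furthermore, assume that the geodesic curvature $k$ and the torsion $\tau$ of the curve $\gamma$ are constant. Then the following relation holds: $$(k^2+\tau^2)^2=K\big((r-1)k^2+\tau^2\big).$$
   Context: Here $I\subset\mathbb{R}$ is an interval, $r$ is a positive integer, and a three-dimensional space form with constant curvature $K$ is a three-dimensional Riemannian manifold of constant sectional curvature $K$. For a smooth curve $\gamma\colon I\to N$ into a Riemannian manifold $N$, $T=\gamma'$ is its tangent vector, $\nabla_T$ is the covariant derivative along $\gamma$ (induced by the Levi-Civita connection of $N$), and $\nabla_T^jT$ denotes its $j$-fold iterate applied to $T$, with $\nabla_T^0T=T$. The curve $\gamma$ is called $r$-harmonic (polyharmonic of order $r$) if it is a critical point of the $r$-energy $E_r(\gamma)=\int_I|\nabla_T^{r-1}T|^2\,ds$, i.e. if it solves $$\nabla^{2r-1}_TT+\sum_{l=0}^{r-2}(-1)^lR^N(\nabla_T^{2r-3-l}T,\nabla_T^lT)T=0,$$ where $R^N$ is the curvature tensor of $N$, with sign convention such that on a space form of sectional curvature $K$ one has $R^N(X,Y)Z=K(\langle Z,Y\rangle X-\langle Z,X\rangle Y)$. For an arclength-parametrized curve in a three-dimensional space form with orthonormal Frenet frame $\{T,F_2,F_3\}$, the geodesic curvature $k$ and the torsion $\tau$ are the functions in the Frenet equations $$\nabla_TT=kF_2,\qquad \nabla_TF_2=-kT+\tau F_3,\qquad \nabla_TF_3=-\tau F_2.$$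
   Formalization: The torsion is taken to be zero where the geodesic curvature k vanishes; otherwise a geodesic with a rotating normal frame (k = 0, τ an arbitrary constant) satisfies the Frenet equations and violates the relation, e.g. a line in flat space with τ = 1. *)

theory Defs
  imports "HOL-Analysis.Analysis"
begin

section \<open>Smooth maps\<close>

text \<open>
  The derivative is taken within \<open>S\<close>, so that the notion also makes sense on an interval with
  endpoints (one-sided derivatives there). It is applied only to open sets and to
  relatively open subsets of nondegenerate intervals; on these the derivative within \<open>S\<close> is unique.
\<close>

primrec C_diff_on :: "nat \<Rightarrow> 'a::euclidean_space set \<Rightarrow> ('a \<Rightarrow> 'b::real_normed_vector) \<Rightarrow> bool" where
  "C_diff_on 0 S f \<longleftrightarrow> continuous_on S f"
| "C_diff_on (Suc n) S f \<longleftrightarrow> f differentiable_on S \<and>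
     (\<forall>v. C_diff_on n S (\<lambda>x. frechet_derivative f (at x within S) v))"

definition smooth_on :: "'a::euclidean_space set \<Rightarrow> ('a \<Rightarrow> 'b::real_normed_vector) \<Rightarrow> bool" where
  "smooth_on S f \<longleftrightarrow> (\<forall>n. C_diff_on n S f)"


section \<open>Riemannian manifolds\<close>

type_synonym ('a, 'n) chart = "'a set \<times> ('a \<Rightarrow> real ^ 'n)"

abbreviation chart_dom :: "('a, 'n) chart \<Rightarrow> 'a set" where "chart_dom c \<equiv> fst c"
abbreviation chart_map :: "('a, 'n) chart \<Rightarrow> 'a \<Rightarrow> real ^ 'n" where "chart_map c \<equiv> snd c"
abbreviation chart_image :: "('a, 'n) chart \<Rightarrow> (real ^ 'n) set" where
  "chart_image c \<equiv> chart_map c ` chart_dom c"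

definition is_chart :: "'a topology \<Rightarrow> ('a, 'n::finite) chart \<Rightarrow> bool" where
  "is_chart X c \<longleftrightarrow> openin X (chart_dom c) \<and> open (chart_image c) \<and>
     homeomorphic_map (subtopology X (chart_dom c)) (top_of_set (chart_image c)) (chart_map c)"

definition transition :: "('a, 'n) chart \<Rightarrow> ('a, 'n) chart \<Rightarrow> real ^ 'n \<Rightarrow> real ^ 'n" where
  "transition c d = chart_map d \<circ> inv_into (chart_dom c) (chart_map c)"

definition smooth_atlas :: "'a topology \<Rightarrow> ('a, 'n::finite) chart set \<Rightarrow> bool" where
  "smooth_atlas X A \<longleftrightarrow> (\<forall>c\<in>A. is_chart X c) \<and> (\<Union>c\<in>A. chart_dom c) = topspace X \<and>
     (\<forall>c\<in>A. \<forall>d\<in>A. smooth_on (chart_map c ` (chart_dom c \<inter> chart_dom d)) (transition c d))"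

text \<open>
  Tensors are given by their components in the charts. A tangent vector at \<open>p\<close> has a component
  vector in each chart around \<open>p\<close>, and these are related by the differentials of the transition
  maps. A matrix field \<open>G\<close> on a coordinate domain stands for the metric \<open>g\<^sub>j\<^sub>k\<close> in that chart.
\<close>

definition coord_inner :: "real ^ 'n ^ 'n \<Rightarrow> real ^ 'n \<Rightarrow> real ^ 'n \<Rightarrow> real" where
  "coord_inner M u v = u \<bullet> (M *v v)"

locale riemannian_manifold =
  fixes X :: "'a topology"
    and A :: "('a, 'n::finite) chart set"
    and g :: "('a, 'n) chart \<Rightarrow> real ^ 'n \<Rightarrow> real ^ 'n ^ 'n"
  assumes hausdorff: "Hausdorff_space X"
    and second_countable: "second_countable X"
    and atlas: "smooth_atlas X A"
    and metric_smooth: "\<And>c. c \<in> A \<Longrightarrow> smooth_on (chart_image c) (g c)"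
    and metric_symmetric: "\<And>c x. c \<in> A \<Longrightarrow> x \<in> chart_image c \<Longrightarrow> transpose (g c x) = g c x"
    and metric_positive:
      "\<And>c x v. c \<in> A \<Longrightarrow> x \<in> chart_image c \<Longrightarrow> v \<noteq> 0 \<Longrightarrow> coord_inner (g c x) v v > 0"
    and metric_tensorial:
      "\<And>c d p u v. c \<in> A \<Longrightarrow> d \<in> A \<Longrightarrow> p \<in> chart_dom c \<inter> chart_dom d \<Longrightarrow>
         coord_inner (g d (chart_map d p))
           (frechet_derivative (transition c d) (at (chart_map c p)) u)
           (frechet_derivative (transition c d) (at (chart_map c p)) v)
         = coord_inner (g c (chart_map c p)) u v"


section \<open>Levi-Civita connection and curvature in a chart\<close>

definition partial_deriv :: "'n \<Rightarrow> (real ^ 'n::finite \<Rightarrow> real) \<Rightarrow> real ^ 'n \<Rightarrow> real" where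
  "partial_deriv j f x = frechet_derivative f (at x) (axis j 1)"

text \<open>\<open>christoffel G i j k\<close> is \<open>\<Gamma>\<^sup>i\<^sub>j\<^sub>k\<close>, that is, \<open>\<nabla>\<^sub>\<partial>\<^sub>j \<partial>\<^sub>k = \<Sum>i. \<Gamma>\<^sup>i\<^sub>j\<^sub>k \<partial>\<^sub>i\<close>.\<close>

definition christoffel ::
  "(real ^ 'n \<Rightarrow> real ^ 'n ^ 'n) \<Rightarrow> 'n::finite \<Rightarrow> 'n \<Rightarrow> 'n \<Rightarrow> real ^ 'n \<Rightarrow> real" where
  "christoffel G i j k x = 1/2 * (\<Sum>l\<in>UNIV. matrix_inv (G x) $ i $ l *
     (partial_deriv j (\<lambda>y. G y $ k $ l) x + partial_deriv k (\<lambda>y. G y $ j $ l) x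
      - partial_deriv l (\<lambda>y. G y $ j $ k) x))"

text \<open>
  Sign convention \<open>R(U,V)W = \<nabla>\<^sub>U \<nabla>\<^sub>V W - \<nabla>\<^sub>V \<nabla>\<^sub>U W - \<nabla>\<^bsub>[U,V]\<^esub> W\<close>; for constant sectional
  curvature \<open>K\<close> it gives \<open>R(U,V)W = K (\<langle>W,V\<rangle> U - \<langle>W,U\<rangle> V)\<close>.
  \<open>riemann_coeff G i j k l\<close> is the \<open>i\<close>-th component of \<open>R(\<partial>\<^sub>k,\<partial>\<^sub>l)\<partial>\<^sub>j\<close>.
\<close>

definition riemann_coeff ::
  "(real ^ 'n \<Rightarrow> real ^ 'n ^ 'n) \<Rightarrow> 'n::finite \<Rightarrow> 'n \<Rightarrow> 'n \<Rightarrow> 'n \<Rightarrow> real ^ 'n \<Rightarrow> real" where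
  "riemann_coeff G i j k l x =
     partial_deriv k (christoffel G i l j) x - partial_deriv l (christoffel G i k j) x
     + (\<Sum>m\<in>UNIV. christoffel G i k m x * christoffel G m l j x
               - christoffel G i l m x * christoffel G m k j x)"

definition riemann ::
  "(real ^ 'n \<Rightarrow> real ^ 'n ^ 'n) \<Rightarrow> real ^ 'n \<Rightarrow> real ^ 'n \<Rightarrow> real ^ 'n \<Rightarrow> real ^ 'n \<Rightarrow> real ^ 'n::finite" where
  "riemann G x U V W =
     (\<chi> i. \<Sum>j\<in>UNIV. \<Sum>k\<in>UNIV. \<Sum>l\<in>UNIV. riemann_coeff G i j k l x * U $ k * V $ l * W $ j)"

definition sectional_curvature ::
  "(real ^ 'n \<Rightarrow> real ^ 'n ^ 'n) \<Rightarrow> real ^ 'n::finite \<Rightarrow> real ^ 'n \<Rightarrow> real ^ 'n \<Rightarrow> real" where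
  "sectional_curvature G x U V =
     coord_inner (G x) (riemann G x U V V) U /
     (coord_inner (G x) U U * coord_inner (G x) V V - (coord_inner (G x) U V)\<^sup>2)"

locale space_form = riemannian_manifold X A g
  for X :: "'a topology" and A :: "('a, 'n::finite) chart set"
    and g :: "('a, 'n) chart \<Rightarrow> real ^ 'n \<Rightarrow> real ^ 'n ^ 'n" +
  fixes K :: real
  assumes constant_curvature:
    "\<And>c x U V. c \<in> A \<Longrightarrow> x \<in> chart_image c \<Longrightarrow> U \<noteq> V \<Longrightarrow> independent {U, V} \<Longrightarrow>
       sectional_curvature (g c) x U V = K"


section \<open>Curves and vector fields along curves\<close>

definition nondegenerate_interval :: "real set \<Rightarrow> bool" where
  "nondegenerate_interval I \<longleftrightarrow> is_interval I \<and> interior I \<noteq> {}"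

definition smooth_curve ::
  "'a topology \<Rightarrow> ('a, 'n::finite) chart set \<Rightarrow> real set \<Rightarrow> (real \<Rightarrow> 'a) \<Rightarrow> bool" where
  "smooth_curve X A I \<gamma> \<longleftrightarrow> continuous_map (top_of_set I) X \<gamma> \<and>
     (\<forall>c\<in>A. smooth_on {s \<in> I. \<gamma> s \<in> chart_dom c} (chart_map c \<circ> \<gamma>))"

text \<open>
  A vector field along \<open>\<gamma>\<close> is given by its component vector \<open>V c s\<close> in every chart \<open>c\<close> around \<open>\<gamma> s\<close>;
  the value of \<open>V c s\<close> for \<open>\<gamma> s\<close> outside of the domain of \<open>c\<close> is irrelevant.
\<close>

type_synonym ('a, 'n) curve_field = "('a, 'n) chart \<Rightarrow> real \<Rightarrow> real ^ 'n"

definition smooth_field_along ::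
  "('a, 'n::finite) chart set \<Rightarrow> real set \<Rightarrow> (real \<Rightarrow> 'a) \<Rightarrow> ('a, 'n) curve_field \<Rightarrow> bool" where
  "smooth_field_along A I \<gamma> V \<longleftrightarrow>
     (\<forall>c\<in>A. smooth_on {s \<in> I. \<gamma> s \<in> chart_dom c} (V c)) \<and>
     (\<forall>c\<in>A. \<forall>d\<in>A. \<forall>s\<in>I. \<gamma> s \<in> chart_dom c \<inter> chart_dom d \<longrightarrow>
        V d s = frechet_derivative (transition c d) (at (chart_map c (\<gamma> s))) (V c s))"

definition velocity :: "real set \<Rightarrow> (real \<Rightarrow> 'a) \<Rightarrow> ('a, 'n::finite) curve_field" where
  "velocity I \<gamma> c s = vector_derivative (chart_map c \<circ> \<gamma>) (at s within I)"

definition cov_deriv ::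
  "(('a, 'n) chart \<Rightarrow> real ^ 'n \<Rightarrow> real ^ 'n ^ 'n) \<Rightarrow> real set \<Rightarrow> (real \<Rightarrow> 'a) \<Rightarrow>
   ('a, 'n::finite) curve_field \<Rightarrow> ('a, 'n) curve_field" where
  "cov_deriv g I \<gamma> V c s = vector_derivative (V c) (at s within I) +
     (\<chi> i. \<Sum>j\<in>UNIV. \<Sum>k\<in>UNIV.
        christoffel (g c) i j k (chart_map c (\<gamma> s)) * velocity I \<gamma> c s $ j * V c s $ k)"

definition inner_along ::
  "(('a, 'n) chart \<Rightarrow> real ^ 'n \<Rightarrow> real ^ 'n ^ 'n) \<Rightarrow> (real \<Rightarrow> 'a) \<Rightarrow>
   ('a, 'n::finite) curve_field \<Rightarrow> ('a, 'n) curve_field \<Rightarrow> ('a, 'n) chart \<Rightarrow> real \<Rightarrow> real" where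
  "inner_along g \<gamma> V W c s = coord_inner (g c (chart_map c (\<gamma> s))) (V c s) (W c s)"

definition riemann_along ::
  "(('a, 'n) chart \<Rightarrow> real ^ 'n \<Rightarrow> real ^ 'n ^ 'n) \<Rightarrow> (real \<Rightarrow> 'a) \<Rightarrow> ('a, 'n::finite) curve_field \<Rightarrow>
   ('a, 'n) curve_field \<Rightarrow> ('a, 'n) curve_field \<Rightarrow> ('a, 'n) curve_field" where
  "riemann_along g \<gamma> U V W c s = riemann (g c) (chart_map c (\<gamma> s)) (U c s) (V c s) (W c s)"

definition along_curve ::
  "('a, 'n) chart set \<Rightarrow> real set \<Rightarrow> (real \<Rightarrow> 'a) \<Rightarrow> (('a, 'n) chart \<Rightarrow> real \<Rightarrow> bool) \<Rightarrow> bool" where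
  "along_curve A I \<gamma> P \<longleftrightarrow> (\<forall>s\<in>I. \<forall>c\<in>A. \<gamma> s \<in> chart_dom c \<longrightarrow> P c s)"

definition arclength_parametrized ::
  "('a, 'n::finite) chart set \<Rightarrow> (('a, 'n) chart \<Rightarrow> real ^ 'n \<Rightarrow> real ^ 'n ^ 'n) \<Rightarrow>
   real set \<Rightarrow> (real \<Rightarrow> 'a) \<Rightarrow> bool" where
  "arclength_parametrized A g I \<gamma> \<longleftrightarrow>
     along_curve A I \<gamma> (\<lambda>c s. inner_along g \<gamma> (velocity I \<gamma>) (velocity I \<gamma>) c s = 1)"


section \<open>Polyharmonic curves and Frenet frames\<close>

abbreviation cov_deriv_pow_velocity ::
  "(('a, 'n) chart \<Rightarrow> real ^ 'n \<Rightarrow> real ^ 'n ^ 'n) \<Rightarrow> real set \<Rightarrow> (real \<Rightarrow> 'a) \<Rightarrow>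
   nat \<Rightarrow> ('a, 'n::finite) curve_field" where
  "cov_deriv_pow_velocity g I \<gamma> j \<equiv> (cov_deriv g I \<gamma> ^^ j) (velocity I \<gamma>)"

text \<open>
  The Euler-Lagrange equation of the \<open>r\<close>-energy, for \<open>r \<ge> 1\<close>. The index range \<open>l < r - 1\<close>
  is \<open>0 \<le> l \<le> r - 2\<close>, empty for \<open>r = 1\<close>; on it \<open>l \<le> 2 * r - 3\<close>, so no subtraction truncates.
\<close>

definition r_harmonic ::
  "'a topology \<Rightarrow> ('a, 'n::finite) chart set \<Rightarrow> (('a, 'n) chart \<Rightarrow> real ^ 'n \<Rightarrow> real ^ 'n ^ 'n) \<Rightarrow>
   real set \<Rightarrow> nat \<Rightarrow> (real \<Rightarrow> 'a) \<Rightarrow> bool" where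
  "r_harmonic X A g I r \<gamma> \<longleftrightarrow> smooth_curve X A I \<gamma> \<and>
     along_curve A I \<gamma> (\<lambda>c s.
       cov_deriv_pow_velocity g I \<gamma> (2 * r - 1) c s +
       (\<Sum>l<r - 1. (-1) ^ l *\<^sub>R
          riemann_along g \<gamma>
            (cov_deriv_pow_velocity g I \<gamma> (2 * r - 3 - l))
            (cov_deriv_pow_velocity g I \<gamma> l)
            (velocity I \<gamma>) c s) = 0)"

text \<open>
  Frenet frame \<open>{T, F\<^sub>2, F\<^sub>3}\<close> with geodesic curvature \<open>k\<close> and torsion \<open>\<tau>\<close>, for \<open>T = \<gamma>'\<close>.
  Where \<open>k\<close> vanishes, the curve determines neither the frame nor \<open>\<tau>\<close> (along a geodesic a normal
  frame rotating at any speed satisfies the Frenet equations). The last clause is the usual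
  convention that the torsion is zero there; it is void for \<open>k > 0\<close>.
\<close>

definition frenet_frame ::
  "('a, 3) chart set \<Rightarrow> (('a, 3) chart \<Rightarrow> real ^ 3 \<Rightarrow> real ^ 3 ^ 3) \<Rightarrow> real set \<Rightarrow> (real \<Rightarrow> 'a) \<Rightarrow>
   ('a, 3) curve_field \<Rightarrow> ('a, 3) curve_field \<Rightarrow> (real \<Rightarrow> real) \<Rightarrow> (real \<Rightarrow> real) \<Rightarrow> bool" where
  "frenet_frame A g I \<gamma> F2 F3 k \<tau> \<longleftrightarrow>
     smooth_field_along A I \<gamma> F2 \<and> smooth_field_along A I \<gamma> F3 \<and>
     (let T = velocity I \<gamma>; ip = inner_along g \<gamma>; D = cov_deriv g I \<gamma> in
       along_curve A I \<gamma> (\<lambda>c s.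
         ip T T c s = 1 \<and> ip F2 F2 c s = 1 \<and> ip F3 F3 c s = 1 \<and>
         ip T F2 c s = 0 \<and> ip T F3 c s = 0 \<and> ip F2 F3 c s = 0 \<and>
         D T c s = k s *\<^sub>R F2 c s \<and>
         D F2 c s = - k s *\<^sub>R T c s + \<tau> s *\<^sub>R F3 c s \<and>
         D F3 c s = - \<tau> s *\<^sub>R F2 c s)) \<and>
     (\<forall>s\<in>I. k s = 0 \<longrightarrow> \<tau> s = 0)"

end

theory Submission
  imports Defs
begin

text \<open>
  By the Frenet equations with constant \<open>k\<close>, \<open>\<tau>\<close>, the derivatives \<open>\<nabla>\<^sub>T\<^sup>j T\<close> alternate between
  multiples of \<open>F\<^sub>2\<close> and combinations of \<open>T\<close> and \<open>F\<^sub>3\<close>, with coefficients that are geometric in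
  \<open>-(k\<^sup>2 + \<tau>\<^sup>2)\<close>. In each curvature term of the Euler-Lagrange equation the two derivatives have
  opposite parity, so the \<open>F\<^sub>2\<close>-component of the equation involves only \<open>\<langle>R(F\<^sub>2,T)T, F\<^sub>2\<rangle> = K\<close> and
  \<open>\<langle>R(F\<^sub>2,F\<^sub>3)T, F\<^sub>2\<rangle> = 0\<close>, and every term with \<open>l \<ge> 1\<close> contributes the same amount. The vanishing of
  the second component follows by polarising the constancy of the sectional curvature, from the
  first Bianchi identity and from the skewness of \<open>R(U,V)\<close>; the latter rests on
  the symmetry of the second derivatives of the metric.
\<close>

section \<open>Second derivatives and matrix inverses\<close>

text \<open>Both functions have the same set of derivatives at \<open>x\<close> within
  \<open>S\<close>, so \<open>frechet_derivative\<close> makes the same choice for both, even where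
  the derivative is not unique.\<close>

lemma frechet_derivative_within_cong:
  assumes "x \<in> S" "\<And>y. y \<in> S \<Longrightarrow> f y = g y"
  shows "frechet_derivative f (at x within S) = frechet_derivative g (at x within S)"
proof -
  have "(f has_derivative f') (at x within S) \<longleftrightarrow> (g has_derivative f') (at x within S)" for f'
    using assms has_derivative_transform[of x S f g] has_derivative_transform[of x S g f] by auto
  then show ?thesis
    by (simp add: frechet_derivative_def)
qed

lemma C_diff_on_cong:
  assumes "\<And>x. x \<in> S \<Longrightarrow> f x = g x" "C_diff_on n S f"
  shows "C_diff_on n S g"
  using assms
proof (induction n arbitrary: f g)
  case 0
  then show ?case
    using continuous_on_cong[of S S f g] by simp
next
  case (Suc n)
  have "g differentiable_on S"
    using Suc.prems by (auto simp: differentiable_on_def intro: differentiable_transform_within[where d=1])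
  moreover have "C_diff_on n S (\<lambda>x. frechet_derivative g (at x within S) v)" for v
  proof (rule Suc.IH)
    show "frechet_derivative f (at x within S) v = frechet_derivative g (at x within S) v"
      if "x \<in> S" for x
      using frechet_derivative_within_cong[OF that Suc.prems(1)] by simp
    show "C_diff_on n S (\<lambda>x. frechet_derivative f (at x within S) v)"
      using Suc.prems(2) by simp
  qed
  ultimately show ?case by simp
qed

text \<open>Composition with \<open>L\<close> commutes with differentiation, and on an open set the
  derivative within \<open>S\<close> is unique, so \<open>frechet_derivative\<close> returns exactly
  this composite. Used to pass from a matrix field to its entries.\<close>

lemma C_diff_on_bounded_linear:
  assumes "bounded_linear L" "open S" "C_diff_on n S f"
  shows "C_diff_on n S (\<lambda>x. L (f x))"
  using assms(3)
proof (induction n arbitrary: f)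
  case 0
  then show ?case
    using assms(1) by (auto intro: bounded_linear.continuous_on)
next
  case (Suc n)
  have der: "((\<lambda>x. L (f x)) has_derivative (\<lambda>v. L (frechet_derivative f (at x) v))) (at x)"
    if "x \<in> S" for x
  proof (rule bounded_linear.has_derivative[OF assms(1)])
    show "(f has_derivative frechet_derivative f (at x)) (at x)"
      using Suc.prems that assms(2)
      by (simp add: differentiable_on_eq_differentiable_at frechet_derivative_works)
  qed
  have "(\<lambda>x. L (f x)) differentiable_on S"
    using der assms(2) by (auto simp: differentiable_on_eq_differentiable_at differentiable_def)
  moreover have "C_diff_on n S (\<lambda>x. frechet_derivative (\<lambda>x. L (f x)) (at x within S) v)" for v
  proof (rule C_diff_on_cong)
    show "C_diff_on n S (\<lambda>x. L (frechet_derivative f (at x within S) v))"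
      using Suc by simp
    show "L (frechet_derivative f (at x within S) v)
        = frechet_derivative (\<lambda>x. L (f x)) (at x within S) v" if "x \<in> S" for x
      using frechet_derivative_at[OF der[OF that]] at_within_open[OF that assms(2)] by metis
  qed
  ultimately show ?case by simp
qed

section \<open>Symmetry of second derivatives\<close>

text \<open>The mean value theorem is applied twice to the second difference over the parallelogram
  spanned by \<open>t *\<^sub>R u\<close> and \<open>t *\<^sub>R v\<close>: along \<open>u\<close>
  to \<phi>, then along \<open>v\<close> to \<psi>. The left-hand side is symmetric in
  \<open>u\<close> and \<open>v\<close>, which is what the next lemma exploits.\<close>

lemma second_difference_mvt:
  fixes f :: "'a::real_normed_vector \<Rightarrow> real"
  assumes f: "\<And>y. y \<in> ball x d \<Longrightarrow> (f has_derivative f' y) (at y)"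
    and f': "\<And>y. y \<in> ball x d \<Longrightarrow> ((\<lambda>y. f' y u) has_derivative f'' y) (at y)"
    and t: "0 < t" "t * (norm u + norm v) < d"
  shows "\<exists>\<xi>\<in>ball x d. f (x + t *\<^sub>R u + t *\<^sub>R v) - f (x + t *\<^sub>R u) - f (x + t *\<^sub>R v) + f x = t\<^sup>2 * f'' \<xi> v"
proof -
  have in_ball: "x + a *\<^sub>R u + b *\<^sub>R v \<in> ball x d" if "0 \<le> a" "a \<le> t" "0 \<le> b" "b \<le> t" for a b
  proof -
    have "norm (a *\<^sub>R u + b *\<^sub>R v) \<le> a * norm u + b * norm v"
      using that norm_triangle_ineq[of "a *\<^sub>R u" "b *\<^sub>R v"] by simp
    also have "\<dots> \<le> t * norm u + t * norm v"
      using that by (intro add_mono mult_right_mono) auto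
    also have "\<dots> < d" using t by (simp add: algebra_simps)
    finally show ?thesis using norm_minus_cancel[of "a *\<^sub>R u + b *\<^sub>R v"] by (simp add: dist_norm)
  qed
  have f_lin: "linear (f' y)" if "y \<in> ball x d" for y
    using f[OF that] has_derivative_linear by blast
  have f''_lin: "linear (f'' y)" if "y \<in> ball x d" for y
    using f'[OF that] has_derivative_linear by blast
  have line: "((\<lambda>s. a + s *\<^sub>R w + b) has_derivative (\<lambda>h. h *\<^sub>R w)) (at s within X)"
    for a w b :: 'a and s X
    by (auto intro!: derivative_eq_intros)
  define \<phi> where "\<phi> s = f (x + s *\<^sub>R u + t *\<^sub>R v) - f (x + s *\<^sub>R u)" for s
  have "\<exists>s\<in>{0<..<t}. \<phi> t - \<phi> 0 =
     (f' (x + s *\<^sub>R u + t *\<^sub>R v) (t *\<^sub>R u) - f' (x + s *\<^sub>R u) (t *\<^sub>R u))"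
  proof -
    have "(\<phi> has_derivative (\<lambda>h. f' (x + s *\<^sub>R u + t *\<^sub>R v) (h *\<^sub>R u) - f' (x + s *\<^sub>R u) (h *\<^sub>R u)))
        (at s within {0..t})" if "0 \<le> s" "s \<le> t" for s
    proof -
      have 1: "((\<lambda>s. f (x + s *\<^sub>R u + t *\<^sub>R v)) has_derivative
          (\<lambda>h. f' (x + s *\<^sub>R u + t *\<^sub>R v) (h *\<^sub>R u))) (at s within {0..t})"
        using that t by (intro has_derivative_compose[OF line f] in_ball) auto
      \<comment> \<open>The summand \<open>0 *\<^sub>R v\<close> gives this term the shape that
        \<open>line\<close> and \<open>in_ball\<close> expect.\<close>
      have 2: "((\<lambda>s. f (x + s *\<^sub>R u + 0 *\<^sub>R v)) has_derivative
          (\<lambda>h. f' (x + s *\<^sub>R u + 0 *\<^sub>R v) (h *\<^sub>R u))) (at s within {0..t})"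
        using that t by (intro has_derivative_compose[OF line f] in_ball) auto
      show ?thesis
        using has_derivative_diff[OF 1 2] by (simp add: \<phi>_def[abs_def])
    qed
    then show ?thesis
      using mvt_simple[of 0 t \<phi>
          "\<lambda>s h. f' (x + s *\<^sub>R u + t *\<^sub>R v) (h *\<^sub>R u) - f' (x + s *\<^sub>R u) (h *\<^sub>R u)"] t(1) by simp
  qed
  then obtain s where "s \<in> {0<..<t}" and
    \<phi>: "\<phi> t - \<phi> 0 = f' (x + s *\<^sub>R u + t *\<^sub>R v) (t *\<^sub>R u) - f' (x + s *\<^sub>R u) (t *\<^sub>R u)"
    by blast
  then have s: "0 < s" "s < t" by simp_all
  define \<psi> where "\<psi> p = f' (x + s *\<^sub>R u + p *\<^sub>R v) u" for p
  have "\<exists>p\<in>{0<..<t}. \<psi> t - \<psi> 0 = f'' (x + s *\<^sub>R u + p *\<^sub>R v) ((t - 0) *\<^sub>R v)"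
  proof (rule mvt_simple[OF t(1)])
    show "(\<psi> has_derivative (\<lambda>h. f'' (x + s *\<^sub>R u + p *\<^sub>R v) (h *\<^sub>R v))) (at p within {0..t})"
      if "0 \<le> p" "p \<le> t" for p
    proof -
      have "((\<lambda>p. (x + s *\<^sub>R u) + p *\<^sub>R v + 0) has_derivative (\<lambda>h. h *\<^sub>R v)) (at p within {0..t})"
        by (rule line)
      then have line': "((\<lambda>p. x + s *\<^sub>R u + p *\<^sub>R v) has_derivative (\<lambda>h. h *\<^sub>R v)) (at p within {0..t})"
        by simp
      show ?thesis
        unfolding \<psi>_def
        using that s by (intro has_derivative_compose[OF line' f'] in_ball) auto
    qed
  qed
  then obtain p where "p \<in> {0<..<t}"
    and \<psi>: "\<psi> t - \<psi> 0 = f'' (x + s *\<^sub>R u + p *\<^sub>R v) (t *\<^sub>R v)"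
    unfolding diff_zero by blast
  then have p: "0 < p" "p < t" by simp_all
  let ?\<xi> = "x + s *\<^sub>R u + p *\<^sub>R v"
  have \<xi>: "?\<xi> \<in> ball x d" using in_ball[of s p] s p by simp
  have "f (x + t *\<^sub>R u + t *\<^sub>R v) - f (x + t *\<^sub>R u) - f (x + t *\<^sub>R v) + f x = \<phi> t - \<phi> 0"
    by (simp add: \<phi>_def[abs_def])
  also have "\<dots> = t * (\<psi> t - \<psi> 0)"
    using in_ball[of s t] in_ball[of s 0] s t(1)
    by (simp add: \<phi> \<psi>_def linear_scale f_lin right_diff_distrib)
  also have "\<dots> = t\<^sup>2 * f'' ?\<xi> v"
    by (simp add: \<psi> linear_scale[OF f''_lin[OF \<xi>]] power2_eq_square)
  finally show ?thesis using \<xi> by blast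
qed

text \<open>The same second difference equals \<open>t\<^sup>2\<close> times a value of either mixed
  derivative near \<open>x\<close>. By continuity these values are close to those at
  \<open>x\<close>, which rules out a gap.\<close>

lemma symmetric_second_derivative:
  fixes f :: "'a::real_normed_vector \<Rightarrow> real"
  assumes S: "open S" "x \<in> S"
    and f: "\<And>y. y \<in> S \<Longrightarrow> (f has_derivative f' y) (at y)"
    and fu: "\<And>y. y \<in> S \<Longrightarrow> ((\<lambda>y. f' y u) has_derivative fu y) (at y)"
    and fv: "\<And>y. y \<in> S \<Longrightarrow> ((\<lambda>y. f' y v) has_derivative fv y) (at y)"
    and cont: "continuous_on S (\<lambda>y. fu y v)" "continuous_on S (\<lambda>y. fv y u)"
  shows "fu x v = fv x u"
proof (rule ccontr)
  assume neq: "fu x v \<noteq> fv x u"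
  \<comment> \<open>Half the gap: one number cannot lie strictly within \<open>e\<close> of two
    values that are \<open>2 * e\<close> apart.\<close>
  define e where "e = \<bar>fu x v - fv x u\<bar> / 2"
  have e: "e > 0" using neq by (simp add: e_def)
  have *: "\<exists>d>0. \<forall>y. dist y x < d \<longrightarrow> dist (h y) (h x) < e" if "continuous_on S h" for h :: "'a \<Rightarrow> real"
    using that S e by (simp add: continuous_on_eq_continuous_at continuous_at_eps_delta)
  from *[OF cont(1)] *[OF cont(2)] obtain d1 d2 where d: "d1 > 0" "d2 > 0"
    and d1: "\<forall>y. dist y x < d1 \<longrightarrow> dist (fu y v) (fu x v) < e"
    and d2: "\<forall>y. dist y x < d2 \<longrightarrow> dist (fv y u) (fv x u) < e"
    by (elim exE conjE) (rule that)
  obtain d3 where d3: "d3 > 0" "ball x d3 \<subseteq> S"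
    using S open_contains_ball by blast
  define d where "d = min d3 (min d1 d2)"
  have dpos: "d > 0" and bS: "ball x d \<subseteq> S"
    using d d3 by (auto simp: d_def)
  \<comment> \<open>Small enough for the whole parallelogram to stay in the ball; the
    \<open>1\<close> keeps the denominator positive if \<open>u\<close> and \<open>v\<close> both
    vanish.\<close>
  define t where "t = d / (2 * (norm u + norm v + 1))"
  have pos: "norm u + norm v + 1 > 0" by (smt (verit) norm_ge_zero)
  have t: "t > 0" "t * (norm u + norm v) < d"
  proof -
    show "t > 0" using dpos pos by (simp add: t_def)
    have "t * (norm u + norm v) < t * (2 * (norm u + norm v + 1))"
      using \<open>t > 0\<close> pos by (intro mult_strict_left_mono) auto
    also have "\<dots> = d" using pos by (simp add: t_def)
    finally show "t * (norm u + norm v) < d" .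
  qed
  obtain \<xi> where \<xi>: "\<xi> \<in> ball x d"
    "f (x + t *\<^sub>R u + t *\<^sub>R v) - f (x + t *\<^sub>R u) - f (x + t *\<^sub>R v) + f x = t\<^sup>2 * fu \<xi> v"
    using second_difference_mvt[of x d f f' u fu t v] f fu bS t by blast
  obtain \<eta> where \<eta>: "\<eta> \<in> ball x d"
    "f (x + t *\<^sub>R v + t *\<^sub>R u) - f (x + t *\<^sub>R v) - f (x + t *\<^sub>R u) + f x = t\<^sup>2 * fv \<eta> u"
    using second_difference_mvt[of x d f f' v fv t u] f fv bS t
    unfolding add.commute[of "norm v"] by blast
  have "t\<^sup>2 * fu \<xi> v = t\<^sup>2 * fv \<eta> u"
    unfolding \<xi>(2)[symmetric] \<eta>(2)[symmetric] by (simp add: algebra_simps)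
  then have "fu \<xi> v = fv \<eta> u" using t by simp
  moreover have "dist (fu \<xi> v) (fu x v) < e" "dist (fv \<eta> u) (fv x u) < e"
    using d1 d2 \<xi>(1) \<eta>(1) by (auto simp: d_def dist_commute)
  ultimately show False
    by (auto simp: e_def dist_real_def abs_if split: if_splits)
qed

section \<open>Differentiability of the inverse matrix\<close>

lemma det_differentiable:
  fixes M :: "'a::real_normed_vector \<Rightarrow> real ^ 'n ^ 'n"
  assumes "\<And>i j. (\<lambda>y. M y $ i $ j) differentiable (at x within S)"
  shows "(\<lambda>y. det (M y)) differentiable (at x within S)"
proof -
  have D: "((\<lambda>y. M y $ i $ j) has_derivative frechet_derivative (\<lambda>y. M y $ i $ j) (at x within S))
      (at x within S)" for i j
    using assms frechet_derivative_works by blast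
  show ?thesis
    unfolding det_def
    by (rule differentiableI, rule has_derivative_sum, rule has_derivative_mult_right,
        rule has_derivative_prod, rule D)
qed

lemma invertible_matrix_inv:
  fixes M :: "real ^ 'n ^ 'n"
  assumes "invertible M"
  shows "M ** matrix_inv M = mat 1" "matrix_inv M ** M = mat 1"
  using assms someI_ex[of "\<lambda>B. M ** B = mat 1 \<and> B ** M = mat 1"]
  unfolding matrix_inv_def by (auto simp: invertible_def)

text \<open>Column \<open>j\<close> of the inverse solves \<open>M *v y = axis j 1\<close>, so
  Cramer's rule applies. The quotient of determinants makes the dependence on the entries of
  \<open>M\<close> explicit.\<close>

lemma matrix_inv_entry_cramer:
  fixes M :: "real ^ 'n ^ 'n"
  assumes "det M \<noteq> 0"
  shows "matrix_inv M $ i $ j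
    = det (\<chi> a b. if b = i then axis j 1 $ a else M $ a $ b) / det M"
proof -
  have "M ** matrix_inv M = mat 1"
    using assms by (simp add: invertible_matrix_inv invertible_det_nz)
  then have "M *v (matrix_inv M *v axis j 1) = axis j 1"
    by (simp add: matrix_vector_mul_assoc)
  then have "matrix_inv M *v axis j 1
      = (\<chi> k. det (\<chi> a b. if b = k then axis j 1 $ a else M $ a $ b) / det M)"
    using cramer[OF assms] by blast
  then have "(matrix_inv M *v axis j 1) $ i
      = det (\<chi> a b. if b = i then axis j 1 $ a else M $ a $ b) / det M" by simp
  then show ?thesis
    by (simp add: matrix_vector_mul_component inner_axis' matrix_vector_mult_basis column_def)
qed

lemma matrix_inv_entry_differentiable:
  fixes M :: "'a::real_normed_vector \<Rightarrow> real ^ 'n ^ 'n"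
  assumes "open S" "x \<in> S" "\<And>i j. (\<lambda>y. M y $ i $ j) differentiable at x"
    and nz: "\<And>y. y \<in> S \<Longrightarrow> det (M y) \<noteq> 0"
  shows "(\<lambda>y. matrix_inv (M y) $ i $ j) differentiable at x"
proof -
  have "(\<lambda>y. det (\<chi> a b. if b = i then axis j 1 $ a else M y $ a $ b) / det (M y)) differentiable at x"
  proof (rule differentiable_divide)
    have "(\<lambda>y. (if b = i then axis j 1 $ a else M y $ a $ b)) differentiable at x" for a b
      using assms(3) by (cases "b = i") auto
    then show "(\<lambda>y. det (\<chi> a b. if b = i then axis j 1 $ a else M y $ a $ b)) differentiable at x"
      by (intro det_differentiable) simp
  qed (use assms in \<open>auto intro: det_differentiable\<close>)
  then obtain D where
    "((\<lambda>y. det (\<chi> a b. if b = i then axis j 1 $ a else M y $ a $ b) / det (M y)) has_derivative D) (at x)"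
    unfolding differentiable_def by blast
  then have "((\<lambda>y. matrix_inv (M y) $ i $ j) has_derivative D) (at x)"
    by (rule has_derivative_transform_within_open[OF _ assms(1,2)])
      (simp add: matrix_inv_entry_cramer nz)
  then show ?thesis
    unfolding differentiable_def by blast
qed

section \<open>Symmetries of the curvature tensor\<close>

lemma partial_deriv_eq: "(f has_derivative f') (at x) \<Longrightarrow> partial_deriv j f x = f' (axis j 1)"
  unfolding partial_deriv_def by (drule frechet_derivative_at) simp

lemma partial_deriv_cong:
  assumes "open S" "x \<in> S" "\<And>y. y \<in> S \<Longrightarrow> f y = g y"
  shows "partial_deriv j f x = partial_deriv j g x"
  using frechet_derivative_within_cong[OF assms(2,3)]
  by (simp add: partial_deriv_def at_within_open[OF assms(2,1)])

lemma partial_deriv_add: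
  assumes "f differentiable at x" "g differentiable at x"
  shows "partial_deriv j (\<lambda>y. f y + g y) x = partial_deriv j f x + partial_deriv j g x"
  using partial_deriv_eq[OF has_derivative_add[OF assms[unfolded frechet_derivative_works]]]
  by (simp add: partial_deriv_def)

lemma partial_deriv_mult:
  assumes "f differentiable at x" "g differentiable at x"
  shows "partial_deriv j (\<lambda>y. f y * g y) x = f x * partial_deriv j g x + partial_deriv j f x * g x"
  using partial_deriv_eq[OF has_derivative_mult[OF assms[unfolded frechet_derivative_works]]]
  by (simp add: partial_deriv_def)

lemma partial_deriv_sum:
  assumes "\<And>i. i \<in> A \<Longrightarrow> f i differentiable at x"
  shows "partial_deriv j (\<lambda>y. \<Sum>i\<in>A. f i y) x = (\<Sum>i\<in>A. partial_deriv j (f i) x)"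
  using partial_deriv_eq[OF has_derivative_sum[of A f _ "at x", OF assms[unfolded frechet_derivative_works]]]
  by (simp add: partial_deriv_def)

text \<open>On an open \<open>S\<close> the derivatives within \<open>S\<close> are derivatives at
  points, so one step of the recursion in \<open>C_diff_on\<close>, taken in direction
  \<open>axis l 1\<close>, is \<open>partial_deriv l\<close>. The commutation is
  \<open>symmetric_second_derivative\<close> for two axis directions.\<close>

lemma C_diff_on_2D:
  fixes f :: "real ^ 'n \<Rightarrow> real"
  assumes f: "C_diff_on 2 S f" and S: "open S" "x \<in> S"
  shows C_diff_on_2_differentiable: "f differentiable at x"
    and C_diff_on_2_partial_differentiable: "partial_deriv l f differentiable at x"
    and C_diff_on_2_partial_commute:
      "partial_deriv m (partial_deriv l f) x = partial_deriv l (partial_deriv m f) x"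
proof -
  let ?P = "\<lambda>l y. frechet_derivative f (at y within S) (axis l 1)"
  have eq: "?P l y = partial_deriv l f y" if "y \<in> S" for l y
    by (simp add: partial_deriv_def at_within_open[OF that S(1)])
  have d1: "f differentiable at y" if "y \<in> S" for y
    using f that S by (simp add: numeral_2_eq_2 differentiable_on_eq_differentiable_at)
  have "C_diff_on 1 S (?P l)" for l
    using f by (simp add: numeral_2_eq_2)
  then have C1: "C_diff_on 1 S (partial_deriv l f)" for l
    using eq C_diff_on_cong[of S "?P l" "partial_deriv l f" 1] by blast
  then have d2: "partial_deriv l f differentiable at y" if "y \<in> S" for l y
    using that S by (simp add: differentiable_on_eq_differentiable_at)
  have cont: "continuous_on S (\<lambda>y. frechet_derivative (partial_deriv l f) (at y) (axis m 1))" for l m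
  proof -
    have "continuous_on S (\<lambda>y. frechet_derivative (partial_deriv l f) (at y within S) (axis m 1))"
      using C1[of l] by simp
    then show ?thesis
      by (rule continuous_on_eq) (simp add: at_within_open[OF _ S(1)])
  qed
  have d2': "((\<lambda>y. frechet_derivative f (at y) (axis l 1)) has_derivative
      frechet_derivative (partial_deriv l f) (at y)) (at y)" if "y \<in> S" for l y
    using d2[OF that, of l] unfolding frechet_derivative_works
    by (simp add: partial_deriv_def[abs_def])
  show "f differentiable at x" "partial_deriv l f differentiable at x"
    using d1 d2 S by auto
  show "partial_deriv m (partial_deriv l f) x = partial_deriv l (partial_deriv m f) x"
    unfolding partial_deriv_def[of _ "partial_deriv _ _"]
    by (rule symmetric_second_derivative[OF S d1[unfolded frechet_derivative_works] d2' d2' cont cont])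
qed

text \<open>The Christoffel symbols of the first kind \<open>\<Gamma>\<^sub>p\<^sub>,\<^sub>j\<^sub>k = \<Sum>i. g\<^sub>p\<^sub>i \<Gamma>\<^sup>i\<^sub>j\<^sub>k\<close>.\<close>

definition christoffel_low ::
  "(real ^ 'n \<Rightarrow> real ^ 'n ^ 'n) \<Rightarrow> 'n::finite \<Rightarrow> 'n \<Rightarrow> 'n \<Rightarrow> real ^ 'n \<Rightarrow> real" where
  "christoffel_low G p j k x = 1/2 * (partial_deriv j (\<lambda>y. G y $ k $ p) x
      + partial_deriv k (\<lambda>y. G y $ j $ p) x - partial_deriv p (\<lambda>y. G y $ j $ k) x)"

lemma christoffel_eq_sum_low:
  "christoffel G i j k x = (\<Sum>p\<in>UNIV. matrix_inv (G x) $ i $ p * christoffel_low G p j k x)"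
  unfolding christoffel_def christoffel_low_def by (simp add: sum_distrib_left)

lemma coord_inner_linear:
  "coord_inner M (u + u') v = coord_inner M u v + coord_inner M u' v"
  "coord_inner M u (v + v') = coord_inner M u v + coord_inner M u v'"
  "coord_inner M (a *\<^sub>R u) v = a * coord_inner M u v"
  "coord_inner M u (a *\<^sub>R v) = a * coord_inner M u v"
  "coord_inner M (- u) v = - coord_inner M u v"
  "coord_inner M (u - u') v = coord_inner M u v - coord_inner M u' v"
  "coord_inner M 0 v = 0"
  by (simp_all add: coord_inner_def inner_add_left inner_diff_left inner_add_right matrix_vector_right_distrib
      matrix_vector_mult_scaleR)

lemma coord_inner_sum: "coord_inner M (\<Sum>i\<in>A. f i) v = (\<Sum>i\<in>A. coord_inner M (f i) v)"
  by (simp add: coord_inner_def inner_sum_left)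

lemma riemann_linear:
  "riemann G x (U + U') V W = riemann G x U V W + riemann G x U' V W"
  "riemann G x U (V + V') W = riemann G x U V W + riemann G x U V' W"
  "riemann G x U V (W + W') = riemann G x U V W + riemann G x U V W'"
  "riemann G x (a *\<^sub>R U) V W = a *\<^sub>R riemann G x U V W"
  "riemann G x U (a *\<^sub>R V) W = a *\<^sub>R riemann G x U V W"
  by (simp_all add: vec_eq_iff riemann_def distrib_left distrib_right sum.distrib sum_distrib_left
      mult.assoc mult.left_commute)

lemma riemann_antisym: "riemann G x U V W = - riemann G x V U W"
proof -
  have *: "riemann_coeff G i j k l x = - riemann_coeff G i j l k x" for i j k l
    by (simp add: riemann_coeff_def sum_subtractf)
  have "(\<Sum>j\<in>UNIV. \<Sum>k\<in>UNIV. \<Sum>l\<in>UNIV. riemann_coeff G i j k l x * U $ k * V $ l * W $ j)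
      = - (\<Sum>j\<in>UNIV. \<Sum>k\<in>UNIV. \<Sum>l\<in>UNIV. riemann_coeff G i j k l x * V $ k * U $ l * W $ j)" for i
    unfolding sum_negf[symmetric]
    by (rule sum.cong[OF refl], subst sum.swap, intro sum.cong refl, subst *) simp
  then show ?thesis
    by (simp add: vec_eq_iff riemann_def)
qed

section \<open>Connection and curvature of a metric in one chart\<close>

locale chart_metric =
  fixes S :: "(real ^ 'n::finite) set" and G :: "real ^ 'n \<Rightarrow> real ^ 'n ^ 'n"
  assumes open_S: "open S"
    and C2: "C_diff_on 2 S G"
    and symmetric: "\<And>x. x \<in> S \<Longrightarrow> transpose (G x) = G x"
    and positive: "\<And>x v. x \<in> S \<Longrightarrow> v \<noteq> 0 \<Longrightarrow> coord_inner (G x) v v > 0"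
begin

lemma entry_sym: "x \<in> S \<Longrightarrow> G x $ i $ j = G x $ j $ i"
  using arg_cong[OF symmetric, of x "\<lambda>M. M $ j $ i"] by (simp add: transpose_def)

lemma invertible_G: "x \<in> S \<Longrightarrow> invertible (G x)"
proof -
  assume x: "x \<in> S"
  have "v = 0" if "G x *v v = 0" for v
    using positive[OF x, of v] that by (auto simp: coord_inner_def)
  then show ?thesis
    by (simp add: invertible_left_inverse matrix_left_invertible_ker)
qed

lemmas inverse_mult = invertible_matrix_inv[OF invertible_G]

lemma inverse_sym:
  assumes "x \<in> S"
  shows "matrix_inv (G x) $ i $ j = matrix_inv (G x) $ j $ i"
proof -
  have "transpose (matrix_inv (G x)) ** G x = mat 1"
    using arg_cong[OF inverse_mult(1)[OF assms], of transpose]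
    by (simp add: matrix_transpose_mul symmetric assms)
  then have "transpose (matrix_inv (G x)) = matrix_inv (G x)"
    using inverse_mult(1)[OF assms] matrix_mul_assoc matrix_mul_lid matrix_mul_rid by metis
  then have "transpose (matrix_inv (G x)) $ i $ j = matrix_inv (G x) $ i $ j" by simp
  then show ?thesis by (simp add: transpose_def)
qed

lemma entry_C2: "C_diff_on 2 S (\<lambda>y. G y $ j $ k)"
proof (rule C_diff_on_bounded_linear[OF _ open_S C2])
  show "bounded_linear (\<lambda>M::real ^ 'n ^ 'n. M $ j $ k)"
    by (intro bounded_linear_compose[OF bounded_linear_vec_nth] bounded_linear_vec_nth)
qed

lemmas entry_differentiable = C_diff_on_2_differentiable[OF entry_C2 open_S]
lemmas entry_partial_differentiable = C_diff_on_2_partial_differentiable[OF entry_C2 open_S]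
lemmas entry_partial_commute = C_diff_on_2_partial_commute[OF entry_C2 open_S]

lemma entry_partial_sym:
  "x \<in> S \<Longrightarrow> partial_deriv l (\<lambda>y. G y $ i $ j) x = partial_deriv l (\<lambda>y. G y $ j $ i) x"
  by (rule partial_deriv_cong[OF open_S]) (auto simp: entry_sym)

lemma christoffel_low_sym: "x \<in> S \<Longrightarrow> christoffel_low G p j k x = christoffel_low G p k j x"
  by (simp add: christoffel_low_def entry_partial_sym[of x p j k])

lemma christoffel_sym: "x \<in> S \<Longrightarrow> christoffel G i j k x = christoffel G i k j x"
  by (simp add: christoffel_eq_sum_low christoffel_low_sym[of x _ j k])

lemma christoffel_low_differentiable:
  assumes "x \<in> S" shows "christoffel_low G p j k differentiable at x"
proof -
  have "(\<lambda>x. 1/2 * (partial_deriv j (\<lambda>y. G y $ k $ p) x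
      + partial_deriv k (\<lambda>y. G y $ j $ p) x - partial_deriv p (\<lambda>y. G y $ j $ k) x)) differentiable at x"
    by (intro differentiable_mult differentiable_const differentiable_diff differentiable_add
        entry_partial_differentiable assms)
  then show ?thesis by (simp add: christoffel_low_def[abs_def])
qed

lemma christoffel_differentiable:
  assumes "x \<in> S" shows "christoffel G i j k differentiable at x"
proof -
  have "(\<lambda>y. \<Sum>p\<in>UNIV. matrix_inv (G y) $ i $ p * christoffel_low G p j k y) differentiable at x"
    by (intro differentiable_sum finite differentiable_mult ballI christoffel_low_differentiable assms
        matrix_inv_entry_differentiable[OF open_S assms] entry_differentiable)
      (auto simp: invertible_det_nz[symmetric] invertible_G)
  then show ?thesis by (simp add: christoffel_eq_sum_low[abs_def])
qed

text \<open>This is \<nabla>g = 0 in coordinates. In the sum of the two symbols the derivatives in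
  directions \<open>p\<close> and \<open>j\<close> cancel, and the symmetry of the metric merges the
  two derivatives in direction \<open>l\<close>.\<close>

lemma metric_compatible:
  assumes "x \<in> S"
  shows "partial_deriv l (\<lambda>y. G y $ p $ j) x = christoffel_low G p l j x + christoffel_low G j l p x"
  using entry_partial_sym[OF assms, of l j p] by (simp add: christoffel_low_def field_simps)

lemma lower_christoffel:
  assumes "x \<in> S"
  shows "(\<Sum>i\<in>UNIV. G x $ p $ i * christoffel G i j k x) = christoffel_low G p j k x"
proof -
  have "(\<Sum>i\<in>UNIV. G x $ p $ i * christoffel G i j k x)
      = (\<Sum>i\<in>UNIV. \<Sum>q\<in>UNIV. G x $ p $ i * matrix_inv (G x) $ i $ q * christoffel_low G q j k x)"
    by (simp add: christoffel_eq_sum_low sum_distrib_left mult.assoc)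
  also have "\<dots> = (\<Sum>q\<in>UNIV. (G x ** matrix_inv (G x)) $ p $ q * christoffel_low G q j k x)"
    unfolding matrix_matrix_mult_def by (subst sum.swap) (simp add: sum_distrib_right)
  also have "\<dots> = (\<Sum>q\<in>UNIV. if p = q then christoffel_low G q j k x else 0)"
    unfolding inverse_mult(1)[OF assms] mat_def by (intro sum.cong) auto
  finally show ?thesis by simp
qed

text \<open>The product rule applied to \<open>lower_christoffel\<close>, with
  \<open>metric_compatible\<close> for the derivative of the metric. It trades derivatives of the
  raised symbols, which contain the inverse metric, for derivatives of the lowered ones.\<close>

lemma lower_partial_christoffel:
  assumes "x \<in> S"
  shows "(\<Sum>i\<in>UNIV. G x $ p $ i * partial_deriv m (christoffel G i j k) x)
    = partial_deriv m (christoffel_low G p j k) x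
      - (\<Sum>i\<in>UNIV. (christoffel_low G p m i x + christoffel_low G i m p x) * christoffel G i j k x)"
proof -
  have "partial_deriv m (christoffel_low G p j k) x
      = partial_deriv m (\<lambda>y. \<Sum>i\<in>UNIV. G y $ p $ i * christoffel G i j k y) x"
    by (rule partial_deriv_cong[OF open_S assms]) (simp add: lower_christoffel)
  also have "\<dots> = (\<Sum>i\<in>UNIV. G x $ p $ i * partial_deriv m (christoffel G i j k) x
      + partial_deriv m (\<lambda>y. G y $ p $ i) x * christoffel G i j k x)"
    by (subst partial_deriv_sum)
      (auto intro!: differentiable_mult entry_differentiable christoffel_differentiable assms
        simp: partial_deriv_mult entry_differentiable christoffel_differentiable assms)
  finally show ?thesis
    by (simp add: sum.distrib metric_compatible[OF assms])
qed

text \<open>The products with \<open>christoffel_low G p k\<close> and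
  \<open>christoffel_low G p l\<close> that the product rule creates cancel against the quadratic
  terms of the curvature. What remains is a form in which exchanging \<open>p\<close> and
  \<open>j\<close> can be analysed.\<close>

lemma lower_riemann_coeff:
  assumes "x \<in> S"
  shows "(\<Sum>i\<in>UNIV. G x $ p $ i * riemann_coeff G i j k l x)
    = partial_deriv k (christoffel_low G p l j) x - partial_deriv l (christoffel_low G p k j) x
      - (\<Sum>i\<in>UNIV. christoffel_low G i k p x * christoffel G i l j x)
      + (\<Sum>i\<in>UNIV. christoffel_low G i l p x * christoffel G i k j x)"
proof -
  have "(\<Sum>i\<in>UNIV. G x $ p $ i * (\<Sum>m\<in>UNIV. christoffel G i a m x * christoffel G m b j x))
      = (\<Sum>m\<in>UNIV. christoffel_low G p a m x * christoffel G m b j x)" for a b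
  proof -
    have "(\<Sum>i\<in>UNIV. G x $ p $ i * (\<Sum>m\<in>UNIV. christoffel G i a m x * christoffel G m b j x))
      = (\<Sum>m\<in>UNIV. (\<Sum>i\<in>UNIV. G x $ p $ i * christoffel G i a m x) * christoffel G m b j x)"
      by (subst sum_distrib_left, subst sum.swap) (simp add: sum_distrib_right mult.assoc)
    then show ?thesis by (simp add: lower_christoffel[OF assms])
  qed
  then show ?thesis
    by (simp add: riemann_coeff_def sum_subtractf sum.distrib lower_partial_christoffel[OF assms]
        algebra_simps)
qed

text \<open>Both sides pair two lowered symbols by the inverse metric, which is symmetric.\<close>

lemma christoffel_contract_sym:
  assumes "x \<in> S"
  shows "(\<Sum>i\<in>UNIV. christoffel_low G i a b x * christoffel G i c d x)
    = (\<Sum>i\<in>UNIV. christoffel_low G i c d x * christoffel G i a b x)"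
  unfolding christoffel_eq_sum_low sum_distrib_left
  by (subst sum.swap) (intro sum.cong refl, subst inverse_sym[OF assms], simp)

text \<open>Add \<open>lower_riemann_coeff\<close> for (\<open>p\<close>, \<open>j\<close>) and for
  (\<open>j\<close>, \<open>p\<close>). By metric compatibility the derivative terms become a
  commutator of second partial derivatives of the metric, which vanishes; the quadratic terms cancel
  by \<open>christoffel_contract_sym\<close>.\<close>

lemma lower_riemann_coeff_antisym:
  assumes "x \<in> S"
  shows "(\<Sum>i\<in>UNIV. G x $ p $ i * riemann_coeff G i j k l x)
    = - (\<Sum>i\<in>UNIV. G x $ j $ i * riemann_coeff G i p k l x)"
proof -
  have "partial_deriv k (christoffel_low G p l j) x + partial_deriv k (christoffel_low G j l p) x
      = partial_deriv k (partial_deriv l (\<lambda>y. G y $ p $ j)) x" for k l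
  proof -
    have "partial_deriv k (\<lambda>y. christoffel_low G p l j y + christoffel_low G j l p y) x
        = partial_deriv k (partial_deriv l (\<lambda>y. G y $ p $ j)) x"
      by (rule partial_deriv_cong[OF open_S assms]) (simp add: metric_compatible)
    then show ?thesis
      by (simp add: partial_deriv_add christoffel_low_differentiable assms)
  qed
  from this[of k l] this[of l k] show ?thesis
    unfolding lower_riemann_coeff[OF assms]
    using christoffel_contract_sym[OF assms, of k p l j] christoffel_contract_sym[OF assms, of l p k j]
      entry_partial_commute[OF assms, of k l p j] by linarith
qed

text \<open>The connection is torsion-free: with symbols symmetric in their lower indices, the terms
  of the cyclic sum cancel in pairs.\<close>

lemma riemann_coeff_bianchi:
  assumes "x \<in> S"
  shows "riemann_coeff G i j k l x + riemann_coeff G i k l j x + riemann_coeff G i l j k x = 0"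
proof -
  have "partial_deriv m (christoffel G i a b) x = partial_deriv m (christoffel G i b a) x" for m a b
    by (rule partial_deriv_cong[OF open_S assms]) (rule christoffel_sym)
  note [simp] = this[of _ l j] this[of _ j k] this[of _ k l]
  note [simp] = christoffel_sym[OF assms, of _ l j] christoffel_sym[OF assms, of _ j k]
    christoffel_sym[OF assms, of _ k l]
  show ?thesis
    by (simp add: riemann_coeff_def sum_subtractf)
qed

lemma riemann_bianchi:
  assumes "x \<in> S"
  shows "riemann G x U V W + riemann G x V W U + riemann G x W U V = 0"
proof (subst vec_eq_iff, intro allI)
  fix i
  let ?s = "\<lambda>f. \<Sum>j\<in>UNIV. \<Sum>k\<in>UNIV. \<Sum>l\<in>UNIV. (f j k l :: real)"
  let ?t = "\<lambda>f. \<lambda>j k l. f k l j"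
  \<comment> \<open>Cyclic renaming of the summation indices, which gives all three sums the common
    factor \<open>U $ k * V $ l * W $ j\<close>.\<close>
  have rot: "?s f = ?s (?t f)" for f :: "'n \<Rightarrow> 'n \<Rightarrow> 'n \<Rightarrow> real"
  proof -
    have "?s (?t f) = (\<Sum>k\<in>UNIV. \<Sum>j\<in>UNIV. \<Sum>l\<in>UNIV. f k l j)"
      by (rule sum.swap)
    also have "\<dots> = ?s f"
      by (rule sum.cong[OF refl], rule sum.swap)
    finally show ?thesis by simp
  qed
  let ?R = "\<lambda>j k l. riemann_coeff G i j k l x"
  have "riemann G x V W U $ i = ?s (\<lambda>j k l. ?R k l j * V $ l * W $ j * U $ k)"
    by (simp add: riemann_def) (subst rot, simp)
  moreover have "riemann G x W U V $ i = ?s (\<lambda>j k l. ?R l j k * W $ j * U $ k * V $ l)"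
    by (simp add: riemann_def) (subst rot, subst rot, simp)
  ultimately have "(riemann G x U V W + riemann G x V W U + riemann G x W U V) $ i
      = ?s (\<lambda>j k l. (?R j k l + ?R k l j + ?R l j k) * (U $ k * V $ l * W $ j))"
    by (simp add: riemann_def sum.distrib[symmetric] algebra_simps)
  then show "(riemann G x U V W + riemann G x V W U + riemann G x W U V) $ i = 0 $ i"
    by (simp add: riemann_coeff_bianchi[OF assms])
qed

lemma coord_inner_commute: "x \<in> S \<Longrightarrow> coord_inner (G x) u v = coord_inner (G x) v u"
  unfolding coord_inner_def
  by (subst dot_lmul_matrix[symmetric])
    (metis inner_commute symmetric transpose_matrix_vector)

text \<open>The inner product is the quadratic form of the matrix \<open>B\<close> at
  \<open>W\<close>, and \<open>B\<close> is skew by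
  \<open>lower_riemann_coeff_antisym\<close>.\<close>

lemma riemann_skew:
  assumes "x \<in> S"
  shows "coord_inner (G x) (riemann G x U V W) W = 0"
proof -
  define L where "L p j k l = (\<Sum>i\<in>UNIV. G x $ p $ i * riemann_coeff G i j k l x)" for p j k l
  define B where "B p j = (\<Sum>k\<in>UNIV. \<Sum>l\<in>UNIV. L p j k l * U $ k * V $ l)" for p j
  have B: "B p j = - B j p" for p j
    unfolding B_def sum_negf[symmetric] L_def
    by (intro sum.cong refl, subst lower_riemann_coeff_antisym[OF assms]) simp
  have "(G x *v riemann G x U V W) $ p = (\<Sum>j\<in>UNIV. B p j * W $ j)" for p
  proof -
    have "(G x *v riemann G x U V W) $ p = (\<Sum>i\<in>UNIV. \<Sum>j\<in>UNIV. \<Sum>k\<in>UNIV. \<Sum>l\<in>UNIV.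
        G x $ p $ i * riemann_coeff G i j k l x * U $ k * V $ l * W $ j)"
      by (simp add: matrix_vector_mult_def riemann_def sum_distrib_left mult.assoc)
    \<comment> \<open>The sum over \<open>i\<close> is moved inwards past \<open>j\<close>,
      \<open>k\<close> and \<open>l\<close>, where it becomes \<open>L\<close>.\<close>
    also have "\<dots> = (\<Sum>j\<in>UNIV. \<Sum>i\<in>UNIV. \<Sum>k\<in>UNIV. \<Sum>l\<in>UNIV.
        G x $ p $ i * riemann_coeff G i j k l x * U $ k * V $ l * W $ j)"
      by (rule sum.swap)
    also have "\<dots> = (\<Sum>j\<in>UNIV. \<Sum>k\<in>UNIV. \<Sum>i\<in>UNIV. \<Sum>l\<in>UNIV.
        G x $ p $ i * riemann_coeff G i j k l x * U $ k * V $ l * W $ j)"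
      by (rule sum.cong[OF refl], rule sum.swap)
    also have "\<dots> = (\<Sum>j\<in>UNIV. \<Sum>k\<in>UNIV. \<Sum>l\<in>UNIV. \<Sum>i\<in>UNIV.
        G x $ p $ i * riemann_coeff G i j k l x * U $ k * V $ l * W $ j)"
      by (rule sum.cong[OF refl], rule sum.cong[OF refl], rule sum.swap)
    also have "\<dots> = (\<Sum>j\<in>UNIV. B p j * W $ j)"
      by (simp add: B_def L_def sum_distrib_right)
    finally show ?thesis .
  qed
  then have inner: "W \<bullet> (G x *v riemann G x U V W) = (\<Sum>p\<in>UNIV. \<Sum>j\<in>UNIV. B p j * (W $ p * W $ j))"
    by (simp add: inner_vec_def sum_distrib_left algebra_simps)
  also have "\<dots> = (\<Sum>p\<in>UNIV. \<Sum>j\<in>UNIV. B j p * (W $ j * W $ p))"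
    by (rule sum.swap)
  also have "\<dots> = - (\<Sum>p\<in>UNIV. \<Sum>j\<in>UNIV. B p j * (W $ p * W $ j))"
    unfolding sum_negf[symmetric] by (intro sum.cong refl, subst B) simp
  finally have "W \<bullet> (G x *v riemann G x U V W) = 0" using inner by linarith
  moreover have "coord_inner (G x) (riemann G x U V W) W = W \<bullet> (G x *v riemann G x U V W)"
    by (subst coord_inner_commute[OF assms]) (simp add: coord_inner_def)
  ultimately show ?thesis by simp
qed

section \<open>Constant sectional curvature\<close>

text \<open>Orthogonality yields linear independence and reduces the denominator of the sectional
  curvature to \<open>coord_inner (G x) V V\<close>. The length of \<open>V\<close> is left free
  because polarisation applies this to a sum of two frame vectors.\<close>

lemma sectional_curvature_orthogonal:
  assumes x: "x \<in> S"
    and K: "\<And>U V. U \<noteq> V \<Longrightarrow> independent {U, V} \<Longrightarrow> sectional_curvature G x U V = K"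
    and U: "coord_inner (G x) U U = 1" and UV: "coord_inner (G x) U V = 0" and V: "V \<noteq> 0"
  shows "coord_inner (G x) (riemann G x U V V) U = K * coord_inner (G x) V V"
proof -
  have VV: "coord_inner (G x) V V > 0" by (rule positive[OF x V])
  have notin: "U \<notin> span {V}"
  proof
    assume "U \<in> span {V}"
    then obtain a where a: "U = a *\<^sub>R V"
      using span_singleton[of V] by auto
    then have "a = 0" using UV VV by (simp add: coord_inner_linear)
    then show False using U a by (simp add: coord_inner_linear)
  qed
  then have "U \<noteq> V" using span_base[of V "{V}"] by auto
  moreover have "independent {U, V}"
    using notin V by (simp add: independent_insert)
  ultimately have "sectional_curvature G x U V = K" by (rule K)
  then show ?thesis
    using VV by (simp add: sectional_curvature_def U UV field_simps)
qed

text \<open>All that the curve equation needs from the curvature: the \<open>T\<close>-part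
  contributes \<open>K\<close> and the \<open>B\<close>-part nothing. The full formula for the
  curvature tensor of a space form is bypassed.\<close>

lemma curvature_normal_component:
  assumes x: "x \<in> S"
    and K: "\<And>U V. U \<noteq> V \<Longrightarrow> independent {U, V} \<Longrightarrow> sectional_curvature G x U V = K"
    and norm: "coord_inner (G x) N N = 1" "coord_inner (G x) T T = 1" "coord_inner (G x) B B = 1"
    and orth: "coord_inner (G x) T N = 0" "coord_inner (G x) T B = 0" "coord_inner (G x) N B = 0"
  shows "coord_inner (G x) (riemann G x N (y *\<^sub>R T + z *\<^sub>R B) T) N = y * K"
proof -
  let ?R = "\<lambda>V W. coord_inner (G x) (riemann G x N V W) N"
  have orth': "coord_inner (G x) N T = 0" "coord_inner (G x) B T = 0"
    using orth coord_inner_commute[OF x] by metis+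
  have nz: "V \<noteq> 0" if "coord_inner (G x) V V > 0" for V
    using that by (auto simp: coord_inner_linear)
  have TT: "?R T T = K"
    using sectional_curvature_orthogonal[OF x K norm(1) orth'(1) nz] norm by simp
  have BB: "?R B B = K"
    using sectional_curvature_orthogonal[OF x K norm(1) orth(3) nz] norm by simp
  have "?R (T + B) (T + B) = K * coord_inner (G x) (T + B) (T + B)"
    by (rule sectional_curvature_orthogonal[OF x K norm(1) _ nz])
      (simp_all add: coord_inner_linear norm orth orth')
  \<comment> \<open>The polarised identity says that \<open>?R\<close> is antisymmetric on \<open>(T, B)\<close>; the Bianchi identity
     and skewness say that it is symmetric.\<close>
  then have "?R T B + ?R B T = 0"
    using TT BB by (simp add: coord_inner_linear riemann_linear norm orth orth' algebra_simps)
  moreover have "?R T B = ?R B T"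
  proof -
    have "coord_inner (G x) (riemann G x N T B + riemann G x T B N + riemann G x B N T) N = 0"
      by (simp add: riemann_bianchi[OF x] coord_inner_linear)
    then show ?thesis
      by (simp add: coord_inner_linear riemann_skew[OF x] riemann_antisym[of _ _ B N])
  qed
  ultimately show ?thesis
    by (simp add: riemann_linear coord_inner_linear TT)
qed

end

section \<open>Curves in a space form\<close>

lemma (in riemannian_manifold) chart_metric: "c \<in> A \<Longrightarrow> chart_metric (chart_image c) (g c)"
  using atlas metric_smooth metric_symmetric metric_positive
  by unfold_locales (auto simp: smooth_atlas_def is_chart_def smooth_on_def)

section \<open>Differentiation along a curve\<close>

text \<open>A connected set with two points has no isolated point. Hence
  \<open>vector_derivative\<close> within \<open>I\<close> is uniquely determined, also at
  endpoints.\<close>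

lemma nondegenerate_interval_at_within:
  assumes "nondegenerate_interval I" "s \<in> I"
  shows "at s within I \<noteq> bot"
proof -
  obtain a e where "e > 0" "ball a e \<subseteq> I"
    using assms(1) by (auto simp: nondegenerate_interval_def mem_interior)
  then have "a \<in> I" "a + e / 2 \<in> I" "a \<noteq> a + e / 2"
    by (auto simp: dist_real_def subset_eq)
  moreover have "connected I"
    using assms(1) by (simp add: nondegenerate_interval_def is_interval_connected)
  ultimately have "s islimpt I"
    using connected_imp_perfect[OF _ assms(2)] by (metis singletonD)
  then show ?thesis by (simp add: trivial_limit_within)
qed

locale smooth_curve_in = riemannian_manifold X A g
  for X :: "'a topology" and A :: "('a, 'n::finite) chart set"
    and g :: "('a, 'n) chart \<Rightarrow> real ^ 'n \<Rightarrow> real ^ 'n ^ 'n" +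
  fixes I :: "real set" and \<gamma> :: "real \<Rightarrow> 'a"
  assumes interval: "nondegenerate_interval I" and smooth: "smooth_curve X A I \<gamma>"
begin

text \<open>\<open>velocity\<close> and \<open>cov_deriv\<close> differentiate within
  \<open>I\<close>, whereas smoothness is stated within the times that the chart covers. These times
  are relatively open in \<open>I\<close>, so the two filters agree.\<close>

lemma at_within_chart:
  assumes "c \<in> A" "s \<in> I" "\<gamma> s \<in> chart_dom c"
  shows "at s within I = at s within {s \<in> I. \<gamma> s \<in> chart_dom c}"
proof -
  have "openin X (chart_dom c)"
    using atlas assms(1) by (simp add: smooth_atlas_def is_chart_def)
  then have "openin (top_of_set I) {s \<in> I. \<gamma> s \<in> chart_dom c}"
    using smooth unfolding smooth_curve_def by (auto dest: openin_continuous_map_preimage)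
  then obtain U where U: "open U" "{s \<in> I. \<gamma> s \<in> chart_dom c} = I \<inter> U"
    by (auto simp: openin_open)
  show ?thesis
    unfolding U(2) by (rule at_within_nhd[OF _ U(1)]) (use assms U(2) in auto)
qed

lemma at_within_not_bot: "s \<in> I \<Longrightarrow> at s within I \<noteq> bot"
  by (rule nondegenerate_interval_at_within[OF interval])

text \<open>Components of a field are arbitrary where the curve is outside the chart, so fields are
  only compared through \<open>along_curve\<close>; by \<open>at_within_chart\<close> the derivative
  sees no other times.\<close>

lemma cov_deriv_cong:
  assumes eq: "along_curve A I \<gamma> (\<lambda>c s. V c s = W c s)"
    and c: "c \<in> A" "s \<in> I" "\<gamma> s \<in> chart_dom c"
  shows "cov_deriv g I \<gamma> V c s = cov_deriv g I \<gamma> W c s"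
proof -
  have "vector_derivative (V c) (at s within I) = vector_derivative (W c) (at s within I)"
    unfolding at_within_chart[OF c]
    by (rule vector_derivative_cong_eq) (use eq c in \<open>auto simp: along_curve_def\<close>)
  moreover have "V c s = W c s"
    using eq c by (simp add: along_curve_def)
  ultimately show ?thesis by (simp add: cov_deriv_def)
qed

lemma cov_deriv_lincomb:
  assumes "V c differentiable (at s within I)" "W c differentiable (at s within I)" "s \<in> I"
  shows "cov_deriv g I \<gamma> (\<lambda>c s. a *\<^sub>R V c s + b *\<^sub>R W c s) c s
    = a *\<^sub>R cov_deriv g I \<gamma> V c s + b *\<^sub>R cov_deriv g I \<gamma> W c s"
proof -
  have "((\<lambda>s. a *\<^sub>R V c s + b *\<^sub>R W c s) has_vector_derivative
      a *\<^sub>R vector_derivative (V c) (at s within I) + b *\<^sub>R vector_derivative (W c) (at s within I))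
      (at s within I)"
    using assms(1,2)[unfolded vector_derivative_works]
    by (intro has_vector_derivative_add bounded_linear.has_vector_derivative[OF bounded_linear_scaleR_right])
  from vector_derivative_within[OF at_within_not_bot[OF assms(3)] this]
  show ?thesis
    by (simp add: cov_deriv_def vec_eq_iff algebra_simps sum.distrib sum_distrib_left)
qed

lemma velocity_differentiable:
  assumes c: "c \<in> A" "s \<in> I" "\<gamma> s \<in> chart_dom c"
  shows "velocity I \<gamma> c differentiable (at s within I)"
proof -
  let ?J = "{s \<in> I. \<gamma> s \<in> chart_dom c}" and ?f = "chart_map c \<circ> \<gamma>"
  have C: "C_diff_on 2 ?J ?f"
    using smooth c by (simp add: smooth_curve_def smooth_on_def)
  \<comment> \<open>Smoothness concerns Frechet derivatives; in one variable such a derivative is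
    determined by its value at \<open>1\<close>, here the velocity.\<close>
  have eq: "frechet_derivative ?f (at t within ?J) 1 = velocity I \<gamma> c t" if t: "t \<in> ?J" for t
  proof -
    have tc: "t \<in> I" "\<gamma> t \<in> chart_dom c" using t by auto
    let ?F = "frechet_derivative ?f (at t within ?J)"
    have F: "(?f has_derivative ?F) (at t within ?J)"
      using C t by (simp add: numeral_2_eq_2 differentiable_on_def frechet_derivative_works)
    then have "linear ?F" by (rule has_derivative_linear)
    have "?F h = h *\<^sub>R ?F 1" for h
      using linear_scale[OF \<open>linear ?F\<close>, of h 1] by simp
    then have "?F = (\<lambda>h. h *\<^sub>R ?F 1)"
      by (rule ext)
    from F this have "(?f has_vector_derivative ?F 1) (at t within I)"
      unfolding has_vector_derivative_def at_within_chart[OF c(1) tc] by (rule has_derivative_eq_rhs)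
    then show ?thesis
      unfolding velocity_def
      by (rule vector_derivative_within[OF at_within_not_bot[OF tc(1)], symmetric])
  qed
  have "(\<lambda>t. frechet_derivative ?f (at t within ?J) 1) differentiable_on ?J"
    using C by (simp add: numeral_2_eq_2)
  then have "(\<lambda>t. frechet_derivative ?f (at t within ?J) 1) differentiable (at s within ?J)"
    using c by (auto simp: differentiable_on_def)
  then show ?thesis
    unfolding at_within_chart[OF c]
    by (rule differentiable_transform_within[where d=1]) (use c eq in auto)
qed

lemma smooth_field_differentiable:
  assumes "smooth_field_along A I \<gamma> V" "c \<in> A" "s \<in> I" "\<gamma> s \<in> chart_dom c"
  shows "V c differentiable (at s within I)"
proof -
  have "C_diff_on 1 {s \<in> I. \<gamma> s \<in> chart_dom c} (V c)"
    using assms(1,2) unfolding smooth_field_along_def smooth_on_def by blast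
  then show ?thesis
    using assms(3,4) unfolding at_within_chart[OF assms(2-4)]
    by (simp add: differentiable_on_def)
qed

text \<open>Constant coefficients leave no derivative terms in the product rule. This is where the
  constancy of curvature and torsion will enter.\<close>

lemma cov_deriv_frame:
  assumes c: "c \<in> A" "s \<in> I" "\<gamma> s \<in> chart_dom c"
    and "smooth_field_along A I \<gamma> P" "smooth_field_along A I \<gamma> Q"
    and V: "along_curve A I \<gamma> (\<lambda>c s. V c s = p *\<^sub>R velocity I \<gamma> c s + q *\<^sub>R P c s + r *\<^sub>R Q c s)"
  shows "cov_deriv g I \<gamma> V c s = p *\<^sub>R cov_deriv g I \<gamma> (velocity I \<gamma>) c s
    + q *\<^sub>R cov_deriv g I \<gamma> P c s + r *\<^sub>R cov_deriv g I \<gamma> Q c s"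
proof -
  let ?T = "velocity I \<gamma>"
  note d = velocity_differentiable[OF c] smooth_field_differentiable[OF assms(4) c]
    smooth_field_differentiable[OF assms(5) c]
  let ?W = "\<lambda>c s. p *\<^sub>R ?T c s + q *\<^sub>R P c s"
  have W: "?W c differentiable (at s within I)"
    using d by (intro differentiable_add differentiable_scaleR differentiable_const)
  have "cov_deriv g I \<gamma> V c s = cov_deriv g I \<gamma> (\<lambda>c s. 1 *\<^sub>R ?W c s + r *\<^sub>R Q c s) c s"
    using V by (intro cov_deriv_cong[OF _ c]) simp
  also have "\<dots> = 1 *\<^sub>R cov_deriv g I \<gamma> ?W c s + r *\<^sub>R cov_deriv g I \<gamma> Q c s"
    by (rule cov_deriv_lincomb[where V = ?W and W = Q, OF W d(3) c(2)])
  also have "cov_deriv g I \<gamma> ?W c s = p *\<^sub>R cov_deriv g I \<gamma> ?T c s + q *\<^sub>R cov_deriv g I \<gamma> P c s"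
    by (rule cov_deriv_lincomb[where V = ?T and W = P, OF d(1,2) c(2)])
  finally show ?thesis by simp
qed

section \<open>Iterated derivatives of the velocity in the Frenet frame\<close>

text \<open>Differentiating \<open>N\<close> twice multiplies it by
  \<open>- (\<kappa>\<^sup>2 + \<theta>\<^sup>2)\<close>, whence the powers. The even case starts at
  order 2, since the velocity itself, of order 0, does not fit its pattern.\<close>

lemma cov_deriv_pow_velocity_frenet:
  fixes \<kappa> \<theta> :: real
  assumes fields: "smooth_field_along A I \<gamma> N" "smooth_field_along A I \<gamma> B"
    and frenet: "along_curve A I \<gamma> (\<lambda>c s.
      cov_deriv g I \<gamma> (velocity I \<gamma>) c s = \<kappa> *\<^sub>R N c s \<and>
      cov_deriv g I \<gamma> N c s = - \<kappa> *\<^sub>R velocity I \<gamma> c s + \<theta> *\<^sub>R B c s \<and>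
      cov_deriv g I \<gamma> B c s = - \<theta> *\<^sub>R N c s)"
  shows "along_curve A I \<gamma> (\<lambda>c s.
    cov_deriv_pow_velocity g I \<gamma> (Suc (2 * m)) c s = ((- (\<kappa>\<^sup>2 + \<theta>\<^sup>2)) ^ m * \<kappa>) *\<^sub>R N c s \<and>
    cov_deriv_pow_velocity g I \<gamma> (Suc (Suc (2 * m))) c s
      = (- (\<kappa>\<^sup>2 + \<theta>\<^sup>2)) ^ m *\<^sub>R (- \<kappa>\<^sup>2 *\<^sub>R velocity I \<gamma> c s + (\<kappa> * \<theta>) *\<^sub>R B c s))"
proof -
  let ?T = "velocity I \<gamma>" and ?D = "cov_deriv g I \<gamma>" and ?w = "- (\<kappa>\<^sup>2 + \<theta>\<^sup>2)"
  \<comment> \<open>The Frenet equations as a linear map on the coefficients \<open>p\<close>,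
    \<open>q\<close>, \<open>r\<close>.\<close>
  have step: "along_curve A I \<gamma> (\<lambda>c s.
      ?D V c s = (- \<kappa> * q) *\<^sub>R ?T c s + (\<kappa> * p - \<theta> * r) *\<^sub>R N c s + (\<theta> * q) *\<^sub>R B c s)"
    if "along_curve A I \<gamma> (\<lambda>c s. V c s = p *\<^sub>R ?T c s + q *\<^sub>R N c s + r *\<^sub>R B c s)" for V p q r
    unfolding along_curve_def
  proof (intro ballI impI)
    fix s c assume c: "s \<in> I" "c \<in> A" "\<gamma> s \<in> chart_dom c"
    have "?D ?T c s = \<kappa> *\<^sub>R N c s \<and> ?D N c s = - \<kappa> *\<^sub>R ?T c s + \<theta> *\<^sub>R B c s
        \<and> ?D B c s = - \<theta> *\<^sub>R N c s"
      using frenet c by (simp only: along_curve_def)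
    then have D: "?D ?T c s = \<kappa> *\<^sub>R N c s" "?D N c s = - \<kappa> *\<^sub>R ?T c s + \<theta> *\<^sub>R B c s"
        "?D B c s = - \<theta> *\<^sub>R N c s"
      by blast+
    show "?D V c s = (- \<kappa> * q) *\<^sub>R ?T c s + (\<kappa> * p - \<theta> * r) *\<^sub>R N c s + (\<theta> * q) *\<^sub>R B c s"
      unfolding cov_deriv_frame[OF c(2,1,3) fields that] D
      by (simp add: algebra_simps)
  qed
  have even: "along_curve A I \<gamma> (\<lambda>c s. (?D ^^ Suc (Suc (2 * m))) ?T c s
      = (- \<kappa> * (?w ^ m * \<kappa>)) *\<^sub>R ?T c s + 0 *\<^sub>R N c s + (\<theta> * (?w ^ m * \<kappa>)) *\<^sub>R B c s)"
    if "along_curve A I \<gamma> (\<lambda>c s. (?D ^^ Suc (2 * m)) ?T c s = (?w ^ m * \<kappa>) *\<^sub>R N c s)" for m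
    using step[of "(?D ^^ Suc (2 * m)) ?T" 0 "?w ^ m * \<kappa>" 0] that by simp
  have odd: "along_curve A I \<gamma> (\<lambda>c s. (?D ^^ Suc (2 * m)) ?T c s = (?w ^ m * \<kappa>) *\<^sub>R N c s)" for m
  proof (induction m)
    case 0
    show ?case using frenet by (simp add: along_curve_def)
  next
    case (Suc m)
    have "\<kappa> * (- \<kappa> * (?w ^ m * \<kappa>)) - \<theta> * (\<theta> * (?w ^ m * \<kappa>)) = ?w ^ Suc m * \<kappa>"
      by (simp add: algebra_simps power2_eq_square)
    then show ?case
      using step[OF even[OF Suc]] by simp
  qed
  show ?thesis
    using odd[of m] even[OF odd, of m]
    by (simp add: along_curve_def algebra_simps power2_eq_square)
qed

end

section \<open>The normal component of the Euler-Lagrange equation\<close>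

text \<open>Serves the curvature sum, whose term for \<open>l = 0\<close> contains the velocity
  itself and differs from the others.\<close>

lemma sum_const_tail:
  fixes f :: "nat \<Rightarrow> real"
  assumes "\<And>l. l < q \<Longrightarrow> f (Suc l) = C"
  shows "(\<Sum>l<Suc q. f l) = f 0 + real q * C"
  unfolding sum.lessThan_Suc_shift using assms by simp

text \<open>The hypothesis \<open>e\<close> is the \<open>F2\<close>-component of the Euler-Lagrange
  equation for \<open>q = r - 2\<close>; for positive \<open>q\<close> one cancels
  \<open>\<kappa> * (- w) ^ (q - 1)\<close>. For \<open>q = 0\<close> the exponent
  \<open>q - 1\<close> truncates, but its term carries the factor \<open>real q\<close>.\<close>

lemma frenet_euler_lagrange_scalar:
  fixes \<kappa> w K :: real
  assumes \<kappa>: "\<kappa> \<noteq> 0" and w: "w \<noteq> 0"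
    and e: "(- w) ^ Suc q * \<kappa> + (K * (- w) ^ q * \<kappa> - real q * (K * \<kappa> ^ 3 * (- w) ^ (q - 1))) = 0"
  shows "w\<^sup>2 = K * (w + real q * \<kappa>\<^sup>2)"
proof (cases q)
  case 0
  then have "\<kappa> * (K - w) = 0" using e by (simp add: algebra_simps)
  then show ?thesis using 0 \<kappa> by (simp add: power2_eq_square)
next
  case (Suc p)
  have "\<kappa> * (- w) ^ p * (w\<^sup>2 - K * w - K * real q * \<kappa>\<^sup>2) = 0"
    using e by (simp add: Suc algebra_simps power2_eq_square power3_eq_cube)
  then have "w\<^sup>2 - K * w - K * real q * \<kappa>\<^sup>2 = 0"
    using \<kappa> w by simp
  then show ?thesis by (simp add: algebra_simps)
qed

theorem theorem1p1:
  fixes X :: "'a topology"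
    and A :: "('a, 3) chart set"
    and g :: "('a, 3) chart \<Rightarrow> real ^ 3 \<Rightarrow> real ^ 3 ^ 3"
    and K :: real
    and I :: "real set"
    and r :: nat
    and \<gamma> :: "real \<Rightarrow> 'a"
    and F2 F3 :: "('a, 3) curve_field"
    and k \<tau> :: "real \<Rightarrow> real"
  assumes "space_form X A g K"
    and "nondegenerate_interval I"
    and "r \<ge> 1"
    and "r_harmonic X A g I r \<gamma>"
    and "arclength_parametrized A g I \<gamma>"
    and "frenet_frame A g I \<gamma> F2 F3 k \<tau>"
    and "k constant_on I" and "\<tau> constant_on I"
  shows "\<forall>s\<in>I. ((k s)\<^sup>2 + (\<tau> s)\<^sup>2)\<^sup>2 = K * ((real r - 1) * (k s)\<^sup>2 + (\<tau> s)\<^sup>2)"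
proof
  fix s assume s: "s \<in> I"
  interpret space_form X A g K by fact
  have smooth: "smooth_curve X A I \<gamma>"
    using assms(4) by (simp add: r_harmonic_def)
  interpret smooth_curve_in X A g I \<gamma>
    using assms(2) smooth by unfold_locales
  define \<kappa> \<theta> where "\<kappa> = k s" and "\<theta> = \<tau> s"
  define w where "w = \<kappa>\<^sup>2 + \<theta>\<^sup>2"
  have const: "k t = \<kappa>" "\<tau> t = \<theta>" if "t \<in> I" for t
    using assms(7,8) s that unfolding constant_on_def \<kappa>_def \<theta>_def by metis+
  show "((k s)\<^sup>2 + (\<tau> s)\<^sup>2)\<^sup>2 = K * ((real r - 1) * (k s)\<^sup>2 + (\<tau> s)\<^sup>2)"
  \<comment> \<open>For a geodesic the convention in \<open>frenet_frame\<close> makes the torsion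
    vanish as well, and both sides are zero.\<close>
  proof (cases "\<kappa> = 0")
    case True
    then have "\<tau> s = 0" "k s = 0"
      using assms(6) s by (auto simp: frenet_frame_def \<kappa>_def)
    then show ?thesis by simp
  next
    case nz: False
    have w: "w > 0" using nz by (simp add: w_def add_pos_nonneg)
    have fields: "smooth_field_along A I \<gamma> F2" "smooth_field_along A I \<gamma> F3"
      using assms(6) by (simp_all add: frenet_frame_def)
    have frenet: "along_curve A I \<gamma> (\<lambda>c s.
      cov_deriv g I \<gamma> (velocity I \<gamma>) c s = \<kappa> *\<^sub>R F2 c s \<and>
      cov_deriv g I \<gamma> F2 c s = - \<kappa> *\<^sub>R velocity I \<gamma> c s + \<theta> *\<^sub>R F3 c s \<and>
      cov_deriv g I \<gamma> F3 c s = - \<theta> *\<^sub>R F2 c s)"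
      using assms(6) const by (simp add: frenet_frame_def Let_def along_curve_def)
    have "\<gamma> s \<in> topspace X"
      using smooth s by (auto simp: smooth_curve_def continuous_map_def)
    \<comment> \<open>The relation concerns the values at \<open>s\<close> only, so a single chart
      around the point suffices.\<close>
    then obtain c where c: "c \<in> A" "\<gamma> s \<in> chart_dom c"
      using atlas unfolding smooth_atlas_def by blast
    define x T N B where "x = chart_map c (\<gamma> s)" and "T = velocity I \<gamma> c s" and "N = F2 c s"
      and "B = F3 c s"
    have x: "x \<in> chart_image c" using c by (simp add: x_def)
    interpret chart_metric "chart_image c" "g c" by (rule chart_metric[OF c(1)])
    let ?ip = "coord_inner (g c x)" and ?R = "riemann (g c) x"
    have on: "?ip T T = 1" "?ip N N = 1" "?ip B B = 1" "?ip T N = 0" "?ip T B = 0" "?ip N B = 0"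
      using assms(6) c s
      by (simp_all add: frenet_frame_def Let_def along_curve_def inner_along_def x_def T_def N_def B_def)
    have BN: "?ip B N = 0" using on coord_inner_commute[OF x] by simp
    have curv: "?ip (?R N (y *\<^sub>R T + z *\<^sub>R B) T) N = y * K" for y z
      by (rule curvature_normal_component[OF x constant_curvature[OF c(1) x]]) (use on in auto)
    define e where "e j = cov_deriv_pow_velocity g I \<gamma> j c s" for j
    have e0: "e 0 = T" by (simp add: e_def T_def)
    have odd: "e (Suc (2 * m)) = ((- w) ^ m * \<kappa>) *\<^sub>R N"
      and even: "e (Suc (Suc (2 * m))) = (- w) ^ m *\<^sub>R (- \<kappa>\<^sup>2 *\<^sub>R T + (\<kappa> * \<theta>) *\<^sub>R B)" for m
      using cov_deriv_pow_velocity_frenet[OF fields frenet, of m] c s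
      by (simp_all only: along_curve_def e_def w_def T_def N_def B_def)
    have EL: "e (2 * r - 1) + (\<Sum>l<r - 1. (-1) ^ l *\<^sub>R ?R (e (2 * r - 3 - l)) (e l) T) = 0"
      using assms(4) c s
      by (simp add: r_harmonic_def along_curve_def riemann_along_def e_def x_def T_def)
    show ?thesis
    \<comment> \<open>For \<open>r = 1\<close> the equation reads
      \<open>\<kappa> *\<^sub>R N = 0\<close>, which contradicts \<kappa> being nonzero.\<close>
    proof (cases "r = 1")
      case True
      then have "\<kappa> *\<^sub>R N = 0" using EL odd[of 0] by simp
      then show ?thesis using nz on(2) by (simp add: coord_inner_linear)
    next
      case False
      \<comment> \<open>With this shift \<open>2 * r - 1\<close>, \<open>2 * r - 3\<close> and
        \<open>r - 1\<close> become \<open>Suc (2 * Suc q)\<close>, \<open>Suc (2 * q)\<close> and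
        \<open>Suc q\<close>, free of subtraction.\<close>
      define q where "q = r - 2"
      have r: "r = Suc (Suc q)" using False assms(3) by (simp add: q_def)
      define f where "f l = (-1) ^ l * ?ip (?R (e (Suc (2 * q) - l)) (e l) T) N" for l
      have "?ip (e (2 * r - 1) + (\<Sum>l<r - 1. (-1) ^ l *\<^sub>R ?R (e (2 * r - 3 - l)) (e l) T)) N = 0"
        unfolding EL by (simp add: coord_inner_linear)
      then have sum: "?ip (e (Suc (2 * Suc q))) N + (\<Sum>l<Suc q. f l) = 0"
        by (simp add: coord_inner_linear coord_inner_sum r f_def)
      have f0: "f 0 = K * (- w) ^ q * \<kappa>"
        using curv[of 1 0] by (simp add: f_def odd e0 riemann_linear coord_inner_linear)
      have ev: "e (Suc (Suc (2 * m))) = (- \<kappa>\<^sup>2 * (- w) ^ m) *\<^sub>R T + ((- w) ^ m * \<kappa> * \<theta>) *\<^sub>R B" for m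
        unfolding even by (simp add: algebra_simps)
      have prod: "?ip (?R (e (Suc (2 * i))) (e (Suc (Suc (2 * j)))) T) N
          = - (K * \<kappa> ^ 3 * (- w) ^ (i + j))" for i j
        unfolding odd ev riemann_linear(4) coord_inner_linear(3) curv
        by (simp add: power_add power2_eq_square power3_eq_cube)
      \<comment> \<open>The two orders add up to \<open>2 * q + 1\<close>, so one is odd and one is
        even. For odd \<open>l\<close> the sign is positive and \<open>prod\<close> applies
        directly; for even \<open>l\<close> the sign is negative and is absorbed by exchanging the
        first two arguments of the curvature. The exponents always add up to
        \<open>q - 1\<close>.\<close>
      have f_Suc: "f (Suc l) = - (K * \<kappa> ^ 3 * (- w) ^ (q - 1))" if "l < q" for l
      proof (cases "even l")
        case True
        then obtain i where i: "l = 2 * i" by (elim evenE)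
        define j where "j = q - i - 1"
        have j: "Suc (2 * q) - Suc l = Suc (Suc (2 * j))" "q - 1 = i + j"
          using that by (auto simp: i j_def)
        have "f (Suc l) = - ?ip (?R (e (Suc (Suc (2 * j)))) (e (Suc (2 * i))) T) N"
          unfolding f_def j by (simp add: i)
        also have "\<dots> = ?ip (?R (e (Suc (2 * i))) (e (Suc (Suc (2 * j)))) T) N"
          by (subst riemann_antisym) (simp add: coord_inner_linear)
        finally show ?thesis unfolding prod j(2) .
      next
        case False
        then obtain j where j: "l = Suc (2 * j)" by (metis oddE Suc_eq_plus1)
        define i where "i = q - j - 1"
        have i: "Suc (2 * q) - Suc l = Suc (2 * i)" "q - 1 = i + j"
          using that by (auto simp: j i_def)
        have "f (Suc l) = ?ip (?R (e (Suc (2 * i))) (e (Suc (Suc (2 * j)))) T) N"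
          unfolding f_def i by (simp add: j)
        then show ?thesis unfolding prod i(2) .
      qed
      have tail: "(\<Sum>l<Suc q. f l) = f 0 + real q * - (K * \<kappa> ^ 3 * (- w) ^ (q - 1))"
        by (rule sum_const_tail) (rule f_Suc)
      have "(- w) ^ Suc q * \<kappa> + (K * (- w) ^ q * \<kappa> + real q * - (K * \<kappa> ^ 3 * (- w) ^ (q - 1))) = 0"
        using sum unfolding tail f0 odd coord_inner_linear on by simp
      then have "w\<^sup>2 = K * (w + real q * \<kappa>\<^sup>2)"
        using nz w by (intro frenet_euler_lagrange_scalar) auto
      then show ?thesis
        by (simp add: w_def r \<kappa>_def \<theta>_def algebra_simps)
    qed
  qed
qed

end
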